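(* For every $t\in\mathbb{N}$ there exists $n_0(t)$ such that for all $n\ge n_0(t)$: if $\mathcal{F},\mathcal{G}\subseteq\mathcal{M}_{2n}$ are $t$-cross-intersecting, then \[|\mathcal{F}|\cdot|\mathcal{G}| \le \big((2(n-t)-1)!!\big)^2.\]
   Context: $\mathcal{M}_{2n}$ is the set of perfect matchings of the complete graph $K_{2n}$ (each a set of $n$ edges). Two families $\mathcal{F},\mathcal{G}\subseteq\mathcal{M}_{2n}$ are $t$-cross-intersecting if $|m\cap m'|\ge t$ for all $m\in\mathcal{F}$, $m'\in\mathcal{G}$. $(2k-1)!!=1\cdot3\cdots(2k-1)$. *)

theory Defs
  imports Main
begin

definition perfect_matchings :: "nat \<Rightarrow> nat set set set" where
  "perfect_matchings n =
     {M. (\<forall>e\<in>M. e \<subseteq> {0..<2*n} \<and> card e = 2) \<and>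
         (\<forall>v\<in>{0..<2*n}. \<exists>!e. e \<in> M \<and> v \<in> e)}"

definition t_cross_intersecting :: "nat \<Rightarrow> nat set set set \<Rightarrow> nat set set set \<Rightarrow> bool" where
  "t_cross_intersecting t F G \<longleftrightarrow> (\<forall>m\<in>F. \<forall>m'\<in>G. card (m \<inter> m') \<ge> t)"

definition odd_double_fact :: "nat \<Rightarrow> nat" where
  "odd_double_fact k = (\<Prod>i\<in>{1..k}. 2*i - 1)"

end

theory Submission
  imports Defs Complex_Main
begin

text \<open>
Write $N_k = (2(n-k)-1)!!$, so that at most $N_{|S|}$ perfect matchings contain a given edge set $S$.

The analytic input is a moment bound: for a fractional matching $w$ of $K_{2n}$ (degrees at most 1)
with all weights at most $1/r$, the sum of $w$ over a random perfect matching is about $1/2$, and it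
is at least 1 with probability at most $(2n+1) e^{-r/16}$. Apply this to the edge densities $w$ of a
family $K$ in which no edge outside $B$ has density above $1/r$: as $1/2 < 1$, a family of
non-negligible size that is spread in the same sense outside $A$ can be $t$-cross-intersecting with
$K$ only if $|A \cap B| \ge t$.

With $r = \sqrt n$, every family outside a negligible part is covered by the stars of cores: sets $A$
of bounded size for which a large subfamily contains $A$ and is spread outside $A$. The cores of $F$
and $G$ are $t$-cross-intersecting. If they do not all share a common $t$-set $T$, then
$|F||G| = O(N_t^2/n)$. If they do, almost all of $F$ and $G$ contains $T$, and a single matching of
$F$ that does not contain $T$ would force $|G| \le \frac{3}{4} N_t$, since the members of $G$
containing $T$ would have to contain one of its $n$ edges outside $T$.
\<close>

section \<open>Double factorials\<close>

lemma odd_double_fact_0 [simp]: "odd_double_fact 0 = 1"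
  by (simp add: odd_double_fact_def)

lemma odd_double_fact_Suc [simp]: "odd_double_fact (Suc k) = (2*k+1) * odd_double_fact k"
  by (simp add: odd_double_fact_def)

lemma odd_double_fact_pos [simp]: "odd_double_fact k > 0"
  by (induction k) auto

text \<open>Factor by factor, $2i-1 \<le> 2i \<le> 2i+1$. As \<open>2^k * fact k\<close> is
  $(2k)!!$, this lemma and the next trade odd double factorials for factorials, which cancel against
  binomial coefficients, at the cost of a factor $2n+1$.\<close>

lemma odd_double_fact_le_double_fact: "odd_double_fact k \<le> 2^k * fact k"
proof (induction k)
  case (Suc k)
  have "odd_double_fact (Suc k) \<le> (2 * Suc k) * (2^k * fact k)"
    unfolding odd_double_fact_Suc by (intro mult_mono Suc) auto
  then show ?case by (simp add: algebra_simps)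
qed simp

lemma double_fact_le_odd_double_fact: "2^k * fact k \<le> (2*k+1) * odd_double_fact k"
proof (induction k)
  case (Suc k)
  have "2^Suc k * fact (Suc k) = (2 * Suc k) * (2^k * fact k :: nat)"
    by (simp add: algebra_simps)
  also have "\<dots> \<le> (2 * Suc k + 1) * ((2*k+1) * odd_double_fact k)"
    by (intro mult_mono Suc) auto
  finally show ?case by simp
qed simp

section \<open>Perfect matchings of a finite vertex set\<close>

text \<open>The vertex set is arbitrary because the counting passes to the vertices left uncovered
  by some edges, and these need not form an interval.\<close>

definition matchings_on :: "'a set \<Rightarrow> 'a set set set" where
  "matchings_on V =
     {M. (\<forall>e\<in>M. e \<subseteq> V \<and> card e = 2) \<and> (\<forall>v\<in>V. \<exists>!e. e \<in> M \<and> v \<in> e)}"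

lemma perfect_matchings_eq: "perfect_matchings n = matchings_on {0..<2*n}"
  by (simp add: perfect_matchings_def matchings_on_def)

definition edges_on :: "'a set \<Rightarrow> 'a set set" where
  "edges_on V = {e. e \<subseteq> V \<and> card e = 2}"

lemma finite_edges_on: "finite V \<Longrightarrow> finite (edges_on V)"
  by (rule finite_subset[of _ "Pow V"]) (auto simp: edges_on_def)

lemma matching_subset_edges: "m \<in> matchings_on V \<Longrightarrow> m \<subseteq> edges_on V"
  by (auto simp: matchings_on_def edges_on_def)

lemma edge_nonempty: "e \<in> edges_on V \<Longrightarrow> \<exists>v. v \<in> e"
  by (metis (mono_tags, lifting) card.empty edges_on_def equals0I mem_Collect_eq zero_neq_numeral)

lemma matching_disjoint:
  assumes "m \<in> matchings_on V" shows "pairwise disjnt m"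
  using assms unfolding matchings_on_def pairwise_def disjnt_def by blast

lemma Union_matching:
  assumes "m \<in> matchings_on V" shows "\<Union>m = V"
  using assms unfolding matchings_on_def by blast

lemma finite_matching: "finite V \<Longrightarrow> m \<in> matchings_on V \<Longrightarrow> finite m"
  using finite_edges_on finite_subset matching_subset_edges by blast

lemma finite_matchings_on: "finite V \<Longrightarrow> finite (matchings_on V)"
  by (rule finite_subset[of _ "Pow (edges_on V)"])
     (auto simp: finite_edges_on dest: matching_subset_edges)

lemma card_Union_disjoint_edges:
  assumes "finite V" "S \<subseteq> edges_on V" "pairwise disjnt S"
  shows "card (\<Union>S) = 2 * card S"
proof -
  have "card (\<Union>S) = (\<Sum>e\<in>S. card e)"
    using assms by (intro card_Union_disjoint)
      (auto simp: edges_on_def intro: finite_subset)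
  also have "\<dots> = (\<Sum>e\<in>S. 2)"
    using assms by (intro sum.cong) (auto simp: edges_on_def)
  finally show ?thesis by simp
qed

lemma card_matching:
  assumes "finite V" "m \<in> matchings_on V" shows "card V = 2 * card m"
  using card_Union_disjoint_edges[of V m] assms matching_disjoint[of m V]
    matching_subset_edges[of m V] Union_matching[of m V] by simp

lemma matching_diff:
  assumes "m \<in> matchings_on V" "S \<subseteq> m"
  shows "m - S \<in> matchings_on (V - \<Union>S)"
proof -
  have d: "e \<inter> f = {}" if "e \<in> m" "f \<in> S" "e \<notin> S" for e f
  proof -
    have "f \<in> m" "e \<noteq> f" using assms(2) that by auto
    then show ?thesis
      using matching_disjoint[OF assms(1)] that(1) by (auto simp: pairwise_def disjnt_def)
  qed
  have "\<exists>!e. e \<in> m - S \<and> v \<in> e" if "v \<in> V - \<Union>S" for v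
  proof -
    have "\<exists>!e. e \<in> m \<and> v \<in> e"
      using assms(1) that by (simp add: matchings_on_def)
    then obtain e where "e \<in> m" "v \<in> e" "\<And>f. f \<in> m \<Longrightarrow> v \<in> f \<Longrightarrow> f = e" by blast
    moreover have "e \<notin> S" using that \<open>v \<in> e\<close> by auto
    ultimately show ?thesis by blast
  qed
  moreover have "e \<subseteq> V - \<Union>S \<and> card e = 2" if e: "e \<in> m - S" for e
  proof -
    have "e \<subseteq> V" "card e = 2"
      using matching_subset_edges[OF assms(1)] e by (auto simp: edges_on_def)
    moreover have "e \<inter> \<Union>S = {}" using d e by auto
    ultimately show ?thesis by auto
  qed
  ultimately show ?thesis by (simp add: matchings_on_def)
qed

text \<open>A fixed vertex \<open>v\<close> has \<open>2*k+1\<close> possible partners, and deleting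
  its edge leaves a perfect matching of \<open>2*k\<close> vertices.\<close>

lemma card_matchings_le:
  assumes "finite V" "card V = 2 * k"
  shows "card (matchings_on V) \<le> odd_double_fact k"
  using assms
proof (induction k arbitrary: V)
  case 0
  then have "V = {}" by simp
  then have "matchings_on V \<subseteq> {{}}"
    unfolding matchings_on_def by auto
  then have "card (matchings_on V) \<le> card {{} :: 'a set set}"
    by (intro card_mono) auto
  then show ?case by simp
next
  case (Suc k)
  then obtain v where v: "v \<in> V" by fastforce
  have sub: "matchings_on V \<subseteq> (\<Union>u\<in>V-{v}. insert {v,u} ` matchings_on (V - {v,u}))"
  proof
    fix m assume m: "m \<in> matchings_on V"
    then obtain e where e: "e \<in> m" "v \<in> e" using v unfolding matchings_on_def by blast
    with m have "e \<subseteq> V" "card e = 2" unfolding matchings_on_def by auto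
    with e obtain u where u: "e = {v,u}" "u \<noteq> v" "u \<in> V"
      by (auto simp: card_2_iff)
    have "m - {e} \<in> matchings_on (V - {v,u})"
      using matching_diff[OF m, of "{e}"] e u by simp
    moreover have "m = insert {v,u} (m - {e})" using e u by auto
    ultimately show "m \<in> (\<Union>u\<in>V-{v}. insert {v,u} ` matchings_on (V - {v,u}))"
      using u by blast
  qed
  have "card (matchings_on V) \<le> card (\<Union>u\<in>V-{v}. insert {v,u} ` matchings_on (V - {v,u}))"
    using Suc.prems by (intro card_mono sub) (auto intro: finite_matchings_on)
  also have "\<dots> \<le> (\<Sum>u\<in>V-{v}. card (insert {v,u} ` matchings_on (V - {v,u})))"
    using Suc.prems by (intro card_UN_le) auto
  also have "\<dots> \<le> (\<Sum>u\<in>V-{v}. odd_double_fact k)"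
  proof (rule sum_mono)
    fix u assume u: "u \<in> V - {v}"
    have "card (V - {v,u}) = 2 * k"
      using u v Suc.prems by (auto simp: card_Diff_subset card_insert_if)
    then have "card (matchings_on (V - {v,u})) \<le> odd_double_fact k"
      using Suc by blast
    then show "card (insert {v,u} ` matchings_on (V - {v,u})) \<le> odd_double_fact k"
      using Suc.prems finite_matchings_on[of "V - {v,u}"] card_image_le le_trans by blast
  qed
  also have "\<dots> = (2*k+1) * odd_double_fact k"
    using Suc.prems v by simp
  finally show ?case by simp
qed

text \<open>Deleting \<open>S\<close> maps the star of \<open>S\<close> injectively into the
  matchings of the vertices that \<open>S\<close> leaves uncovered. An \<open>S\<close> that is not
  a partial matching has an empty star.\<close>

lemma card_star_le:
  assumes "finite V" "card V = 2 * n"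
  shows "card {m \<in> matchings_on V. S \<subseteq> m} \<le> odd_double_fact (n - card S)"
proof (cases "{m \<in> matchings_on V. S \<subseteq> m} = {}")
  case False
  then obtain m where m: "m \<in> matchings_on V" "S \<subseteq> m" by blast
  have S: "S \<subseteq> edges_on V" "pairwise disjnt S" "\<Union>S \<subseteq> V"
    using m matching_subset_edges[OF m(1)] Union_matching[OF m(1)] matching_disjoint[OF m(1)]
    by (auto intro: pairwise_subset)
  have "card (\<Union>S) = 2 * card S"
    using card_Union_disjoint_edges assms S by blast
  then have c: "card (V - \<Union>S) = 2 * (n - card S)"
    using assms S by (simp add: card_Diff_subset finite_subset diff_mult_distrib2)
  have "card {m \<in> matchings_on V. S \<subseteq> m} \<le> card (matchings_on (V - \<Union>S))"
  proof (rule card_inj_on_le)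
    show "inj_on (\<lambda>m. m - S) {m \<in> matchings_on V. S \<subseteq> m}"
      unfolding inj_on_def by blast
    show "(\<lambda>m. m - S) ` {m \<in> matchings_on V. S \<subseteq> m} \<subseteq> matchings_on (V - \<Union>S)"
      using matching_diff by blast
    show "finite (matchings_on (V - \<Union>S))"
      using assms finite_matchings_on by blast
  qed
  also have "\<dots> \<le> odd_double_fact (n - card S)"
    using card_matchings_le c assms by blast
  finally show ?thesis .
next
  case True
  then show ?thesis by (simp only: card.empty le0)
qed

section \<open>Moments of the weight of a random perfect matching\<close>

definition partial_matchings :: "'a set \<Rightarrow> nat \<Rightarrow> 'a set set set" where
  "partial_matchings V s = {S. S \<subseteq> edges_on V \<and> pairwise disjnt S \<and> card S = s}"

lemma finite_partial_matchings: "finite V \<Longrightarrow> finite (partial_matchings V s)"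
  by (rule finite_subset[of _ "Pow (edges_on V)"])
     (auto simp: finite_edges_on partial_matchings_def)

text \<open>After removing the $2s$ vertices covered by a partial matching of size $s$, the remaining
edges have total weight at most $l(n-s)$; this is the recursion of the binomial coefficients.\<close>

lemma sum_partial_matchings_le:
  fixes x :: "'a set \<Rightarrow> real" and l :: real
  assumes V: "finite V" "card V = 2 * n"
    and x: "\<And>e. x e \<ge> 0"
    and l: "l \<ge> 0" "\<And>U. U \<subseteq> V \<Longrightarrow> (\<Sum>e\<in>edges_on U. x e) \<le> l * card U / 2"
  shows "(\<Sum>S\<in>partial_matchings V s. prod x S) \<le> l^s * real (n choose s)"
proof (induction s)
  case 0
  have "partial_matchings V 0 = {{}}"
    using finite_edges_on[OF V(1)] finite_subset
    unfolding partial_matchings_def by fastforce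
  then show ?case by simp
next
  case (Suc s)
  have fin: "finite S" if "S \<in> partial_matchings V k" for S k
    using that V finite_edges_on finite_subset unfolding partial_matchings_def by blast
  have cU: "card (V - \<Union>S) = 2 * (n - s)" if "S \<in> partial_matchings V s" for S
  proof -
    have "card (\<Union>S) = 2 * s" "\<Union>S \<subseteq> V"
      using that card_Union_disjoint_edges[OF V(1), of S]
      unfolding partial_matchings_def edges_on_def by auto
    then show ?thesis
      using V by (simp add: card_Diff_subset finite_subset diff_mult_distrib2)
  qed
  have new: "e \<notin> S \<and> e \<in> edges_on V \<and> (\<forall>f\<in>S. disjnt e f \<and> disjnt f e)"
    if "S \<in> partial_matchings V s" "e \<in> edges_on (V - \<Union>S)" for S e
    using that edge_nonempty[OF that(2)]
    unfolding edges_on_def disjnt_def by blast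
  \<comment> \<open>Double counting: a partial matching of size \<open>Suc s\<close> with a marked
    edge is the same as one of size \<open>s\<close> together with an edge on the vertices it leaves
    uncovered.\<close>
  have "real (Suc s) * (\<Sum>S\<in>partial_matchings V (Suc s). prod x S)
      = (\<Sum>S\<in>partial_matchings V (Suc s). \<Sum>e\<in>S. prod x S)"
    unfolding sum_distrib_left
    by (intro sum.cong) (auto simp: partial_matchings_def)
  also have "\<dots> = (\<Sum>(S,e)\<in>(SIGMA S:partial_matchings V (Suc s). S). prod x S)"
    using V fin by (subst sum.Sigma) (auto intro: finite_partial_matchings)
  also have "\<dots> = (\<Sum>(S,e)\<in>(SIGMA S:partial_matchings V s. edges_on (V - \<Union>S)). prod x S * x e)"
  proof (rule sum.reindex_bij_witness[where i = "\<lambda>(S,e). (insert e S, e)"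
        and j = "\<lambda>(S,e). (S - {e}, e)"])
    fix p assume p: "p \<in> (SIGMA S:partial_matchings V (Suc s). S)"
    then obtain S e where [simp]: "p = (S,e)" and S: "S \<in> partial_matchings V (Suc s)" "e \<in> S"
      by blast
    show "(case case p of (S, e) \<Rightarrow> (S - {e}, e) of (S, e) \<Rightarrow> (insert e S, e)) = p"
      using S by auto
    have "e \<in> edges_on (V - \<Union>(S - {e}))"
      using S unfolding partial_matchings_def edges_on_def pairwise_def disjnt_def by blast
    moreover have "S - {e} \<in> partial_matchings V s"
      using S fin[OF S(1)] unfolding partial_matchings_def by (auto intro: pairwise_subset)
    ultimately show "(case p of (S, e) \<Rightarrow> (S - {e}, e))
        \<in> (SIGMA S:partial_matchings V s. edges_on (V - \<Union>S))"
      by simp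
    show "(case case p of (S, e) \<Rightarrow> (S - {e}, e) of (S, e) \<Rightarrow> prod x S * x e) =
         (case p of (S, e) \<Rightarrow> prod x S)"
      using S fin[OF S(1)] by (simp add: prod.remove mult.commute)
  next
    fix p assume p: "p \<in> (SIGMA S:partial_matchings V s. edges_on (V - \<Union>S))"
    then obtain S e where [simp]: "p = (S,e)"
      and S: "S \<in> partial_matchings V s" "e \<in> edges_on (V - \<Union>S)"
      by blast
    note n = new[OF S]
    show "(case case p of (S, e) \<Rightarrow> (insert e S, e) of (S, e) \<Rightarrow> (S - {e}, e)) = p"
      using n by simp
    have "insert e S \<in> partial_matchings V (Suc s)"
      using n S fin[OF S(1)] unfolding partial_matchings_def by (auto simp: pairwise_insert)
    then show "(case p of (S, e) \<Rightarrow> (insert e S, e)) \<in> (SIGMA S:partial_matchings V (Suc s). S)"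
      by simp
  qed
  also have "\<dots> = (\<Sum>S\<in>partial_matchings V s. prod x S * (\<Sum>e\<in>edges_on (V - \<Union>S). x e))"
    using V by (subst sum.Sigma[symmetric])
      (auto simp: finite_partial_matchings finite_edges_on sum_distrib_left)
  also have "\<dots> \<le> (\<Sum>S\<in>partial_matchings V s. prod x S * (l * real (n - s)))"
  proof (intro sum_mono mult_left_mono)
    fix S assume S: "S \<in> partial_matchings V s"
    show "(\<Sum>e\<in>edges_on (V - \<Union>S). x e) \<le> l * real (n - s)"
      using l(2)[of "V - \<Union>S"] cU[OF S] by auto
    show "0 \<le> prod x S" using x by (simp add: prod_nonneg)
  qed
  also have "\<dots> = l * real (n - s) * (\<Sum>S\<in>partial_matchings V s. prod x S)"
    by (simp add: sum_distrib_right[symmetric] mult.commute)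
  also have "\<dots> \<le> l * real (n - s) * (l^s * real (n choose s))"
    using l by (intro mult_left_mono Suc.IH) auto
  also have "\<dots> = l^Suc s * real ((n - s) * (n choose s))"
    by simp
  also have "(n - s) * (n choose s) = Suc s * (n choose Suc s)"
    by (metis binomial_absorb_comp binomial_absorption)
  finally have "real (Suc s) * (\<Sum>S\<in>partial_matchings V (Suc s). prod x S)
      \<le> real (Suc s) * (l^Suc s * real (n choose Suc s))"
    by (simp only: of_nat_mult mult.left_commute)
  then show ?case
    by (rule mult_left_le_imp_le) simp
qed


text \<open>After multiplication by \<open>2^s * fact s\<close> and the estimate $(2k-1)!! \<le>
  (2k)!!$ for $k = n-s$, the left side collapses to \<open>2^n * fact n\<close>. The factor
  \<open>(1/2)^s / fact s\<close> is what later sums to an exponential.\<close>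

lemma binomial_odd_double_fact_le:
  assumes "s \<le> n"
  shows "real (odd_double_fact (n - s)) * real (n choose s)
           \<le> (2 * real n + 1) * odd_double_fact n * ((1/2)^s / fact s)"
proof -
  have "2^s * fact s * (odd_double_fact (n - s) * (n choose s))
      \<le> 2^s * fact s * ((2^(n-s) * fact (n-s)) * (n choose s))"
    by (intro mult_left_mono mult_right_mono odd_double_fact_le_double_fact) auto
  also have "\<dots> = 2^(s + (n-s)) * (fact s * fact (n-s) * (n choose s))"
    by (simp add: power_add)
  also have "\<dots> = 2^n * fact n"
    using assms by (simp add: binomial_fact_lemma)
  also have "\<dots> \<le> (2*n+1) * odd_double_fact n"
    by (rule double_fact_le_odd_double_fact)
  finally have "real (2^s * fact s * (odd_double_fact (n - s) * (n choose s)))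
      \<le> real ((2*n+1) * odd_double_fact n)"
    by (rule of_nat_mono)
  then show ?thesis
    by (simp add: field_simps power_divide)
qed

lemma sum_power_fact_le_exp:
  fixes x :: real
  assumes "x \<ge> 0"
  shows "(\<Sum>s\<le>n. x^s / fact s) \<le> exp x"
proof -
  have "(\<Sum>s\<le>n. inverse (fact s) * x^s) \<le> (\<Sum>s. inverse (fact s) * x^s)"
    using assms by (intro sum_le_suminf summable_exp) auto
  then show ?thesis
    by (simp add: exp_def divide_inverse mult.commute)
qed

text \<open>Expanding the product over \<open>m\<close> gives the sum of \<open>prod x S\<close>
  over all \<open>S\<close> contained in \<open>m\<close>. After exchanging sums, each
  \<open>S\<close> of size \<open>s\<close> is counted at most $N_s$ times, and the terms of size
  \<open>s\<close> contribute at most a multiple of $(l/2)^s / s!$.\<close>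

lemma sum_prod_matchings_le:
  fixes x :: "'a set \<Rightarrow> real" and l :: real
  assumes V: "finite V" "card V = 2 * n"
    and x: "\<And>e. x e \<ge> 0"
    and l: "l \<ge> 0" "\<And>U. U \<subseteq> V \<Longrightarrow> (\<Sum>e\<in>edges_on U. x e) \<le> l * card U / 2"
  shows "(\<Sum>m\<in>matchings_on V. \<Prod>e\<in>m. 1 + x e)
           \<le> (2 * real n + 1) * odd_double_fact n * exp (l / 2)"
proof -
  have expand: "(\<Prod>e\<in>m. 1 + x e) = (\<Sum>s\<le>n. \<Sum>S | S \<in> partial_matchings V s \<and> S \<subseteq> m. prod x S)"
    if m: "m \<in> matchings_on V" for m
  proof -
    have fm: "finite m" using finite_matching V m by blast
    have "card m = n" using card_matching[OF V(1) m] V by simp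
    then have "Pow m = (\<Union>s\<le>n. {S. S \<in> partial_matchings V s \<and> S \<subseteq> m})"
      using matching_subset_edges[OF m] matching_disjoint[OF m] fm
      unfolding partial_matchings_def
      by (auto intro: pairwise_subset card_mono)
    moreover have "(\<Prod>e\<in>m. 1 + x e) = (\<Sum>S\<in>Pow m. prod x S)"
      using prod_add[OF fm, of x "\<lambda>_. 1"] by (simp add: add.commute)
    moreover have "(\<Sum>S\<in>(\<Union>s\<le>n. {S. S \<in> partial_matchings V s \<and> S \<subseteq> m}). prod x S)
        = (\<Sum>s\<le>n. \<Sum>S | S \<in> partial_matchings V s \<and> S \<subseteq> m. prod x S)"
      using V by (intro sum.UNION_disjoint)
        (auto simp: finite_partial_matchings, auto simp: partial_matchings_def)
    ultimately show ?thesis by simp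
  qed
  have "(\<Sum>m\<in>matchings_on V. \<Prod>e\<in>m. 1 + x e)
      = (\<Sum>s\<le>n. \<Sum>m\<in>matchings_on V. \<Sum>S | S \<in> partial_matchings V s \<and> S \<subseteq> m. prod x S)"
    by (subst sum.swap) (simp add: expand)
  also have "\<dots> = (\<Sum>s\<le>n. \<Sum>S\<in>partial_matchings V s. \<Sum>m | m \<in> matchings_on V \<and> S \<subseteq> m. prod x S)"
    using V by (intro sum.cong refl sum.swap_restrict)
      (auto simp: finite_partial_matchings finite_matchings_on)
  also have "\<dots> \<le> (\<Sum>s\<le>n. \<Sum>S\<in>partial_matchings V s. odd_double_fact (n - s) * prod x S)"
  proof (intro sum_mono)
    fix s S assume "S \<in> partial_matchings V s"
    then have "card {m \<in> matchings_on V. S \<subseteq> m} \<le> odd_double_fact (n - s)"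
      using card_star_le[OF V, of S] by (simp add: partial_matchings_def)
    then show "(\<Sum>m | m \<in> matchings_on V \<and> S \<subseteq> m. prod x S) \<le> odd_double_fact (n - s) * prod x S"
      using x by (auto intro!: mult_right_mono prod_nonneg)
  qed
  also have "\<dots> \<le> (\<Sum>s\<le>n. odd_double_fact (n - s) * (l^s * real (n choose s)))"
    using sum_partial_matchings_le[OF V x l]
    by (auto simp: sum_distrib_left[symmetric] intro!: sum_mono mult_left_mono)
  also have "\<dots> \<le> (\<Sum>s\<le>n. (2 * real n + 1) * odd_double_fact n * ((l/2)^s / fact s))"
  proof (intro sum_mono)
    fix s assume "s \<in> {..n}"
    then have "l^s * (odd_double_fact (n - s) * real (n choose s))
       \<le> l^s * ((2 * real n + 1) * odd_double_fact n * ((1/2)^s / fact s))"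
      using l binomial_odd_double_fact_le by (intro mult_left_mono) auto
    then show "odd_double_fact (n - s) * (l^s * real (n choose s))
       \<le> (2 * real n + 1) * odd_double_fact n * ((l/2)^s / fact s)"
      by (simp add: power_divide mult_ac)
  qed
  also have "\<dots> \<le> (2 * real n + 1) * odd_double_fact n * exp (l / 2)"
    unfolding sum_distrib_left[symmetric]
    using l sum_power_fact_le_exp[of "l/2" n] by (intro mult_left_mono) auto
  finally show ?thesis .
qed

text \<open>Exponential Markov inequality: weight at least 1 forces the product of the
  \<open>1 + x e\<close> to be at least $e^{3r/16}$, while the moment bound with $l = r/4$ only
  allows $e^{r/8}$ on average, up to the factor $2n+1$. The quotient is $e^{-r/16}$.\<close>

lemma card_heavy_matchings_le:
  fixes w :: "'a set \<Rightarrow> real" and r :: real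
  assumes V: "finite V" "card V = 2 * n"
    and w: "\<And>e. w e \<ge> 0" "\<And>U. U \<subseteq> V \<Longrightarrow> (\<Sum>e\<in>edges_on U. w e) \<le> card U / 2"
    and r: "r \<ge> 0" "\<And>e. r * w e \<le> 1"
  shows "card {m \<in> matchings_on V. (\<Sum>e\<in>m. w e) \<ge> 1}
           \<le> (2 * real n + 1) * odd_double_fact n * exp (- r / 16)"
proof -
  define H where "H = {m \<in> matchings_on V. (\<Sum>e\<in>m. w e) \<ge> 1}"
  \<comment> \<open>The scale \<open>r/4\<close> keeps \<open>x e\<close> at most
    \<open>1/4\<close>, where $x - x^2 \<ge> 3x/4$ and hence $1 + x \<ge> e^{3x/4}$.\<close>
  define x where "x = (\<lambda>e. r/4 * w e)"
  have x: "0 \<le> x e" "x e \<le> 1/4" for e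
    using w r(1) r(2)[of e] by (auto simp: x_def)
  have one: "exp (3/4 * x e) \<le> 1 + x e" for e
  proof -
    have "x e * x e \<le> x e * (1/4)"
      using x by (intro mult_left_mono)
    then have "3/4 * x e \<le> x e - (x e)\<^sup>2" by (simp add: power2_eq_square)
    also have "\<dots> \<le> ln (1 + x e)"
      using x[of e] by (intro ln_one_plus_pos_lower_bound) auto
    finally show ?thesis using x[of e] by (subst (asm) ln_ge_iff) auto
  qed
  have "card H * exp (3/16 * r) = (\<Sum>m\<in>H. exp (3/16 * r))" by simp
  also have "\<dots> \<le> (\<Sum>m\<in>H. \<Prod>e\<in>m. 1 + x e)"
  proof (rule sum_mono)
    fix m assume m: "m \<in> H"
    then have fm: "finite m" using finite_matching V by (auto simp: H_def)
    have "3/16 * r * 1 \<le> 3/16 * r * (\<Sum>e\<in>m. w e)"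
      using m r by (intro mult_left_mono) (auto simp: H_def)
    also have "\<dots> = (\<Sum>e\<in>m. 3/4 * x e)"
      unfolding sum_distrib_left by (intro sum.cong) (auto simp: x_def)
    finally have "exp (3/16 * r) \<le> exp (\<Sum>e\<in>m. 3/4 * x e)" by simp
    also have "\<dots> = (\<Prod>e\<in>m. exp (3/4 * x e))"
      using fm by (rule exp_sum)
    also have "\<dots> \<le> (\<Prod>e\<in>m. 1 + x e)"
      using one by (intro prod_mono) auto
    finally show "exp (3/16 * r) \<le> (\<Prod>e\<in>m. 1 + x e)" .
  qed
  also have "\<dots> \<le> (\<Sum>m\<in>matchings_on V. \<Prod>e\<in>m. 1 + x e)"
    using x V by (intro sum_mono2) (auto simp: H_def finite_matchings_on add_nonneg_nonneg intro!: prod_nonneg)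
  also have "\<dots> \<le> (2 * real n + 1) * odd_double_fact n * exp (r / 4 / 2)"
  proof (rule sum_prod_matchings_le[OF V])
    fix U assume "U \<subseteq> V"
    then have "r/4 * (\<Sum>e\<in>edges_on U. w e) \<le> r/4 * (card U / 2)"
      using w r by (intro mult_left_mono) auto
    then show "(\<Sum>e\<in>edges_on U. x e) \<le> r / 4 * card U / 2"
      by (simp add: x_def sum_distrib_left)
  qed (use x r in auto)
  finally have "card H * exp (3/16 * r) * exp (- (3/16 * r))
      \<le> (2 * real n + 1) * odd_double_fact n * exp (r / 8) * exp (- (3/16 * r))"
    by (intro mult_right_mono) auto
  then show ?thesis
    by (simp add: H_def mult.assoc exp_add[symmetric])
qed

lemma sum_card_containing:
  assumes "finite A" "finite K"
  shows "(\<Sum>e\<in>A. card {m \<in> K. e \<in> m}) = (\<Sum>m\<in>K. card (A \<inter> m))"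
proof -
  have "(\<Sum>e\<in>A. \<Sum>m | m \<in> K \<and> e \<in> m. 1) = (\<Sum>m\<in>K. \<Sum>e | e \<in> A \<and> e \<in> m. (1::nat))"
    using assms by (rule sum.swap_restrict)
  then show ?thesis by (simp add: Int_def)
qed

section \<open>Spread families and their intersections\<close>

text \<open>The condition concerns single edges: it is the bound on the maximal weight that the
  moment bound asks of the edge densities of \<open>H\<close>.\<close>

definition spread_outside :: "real \<Rightarrow> 'a set \<Rightarrow> 'a set set \<Rightarrow> bool" where
  "spread_outside r A H \<longleftrightarrow> (\<forall>e. e \<notin> A \<longrightarrow> r * card {m \<in> H. e \<in> m} \<le> card H)"

text \<open>Every matching has at most \<open>card U / 2\<close> edges inside \<open>U\<close>. So
  the edge densities of \<open>K\<close> satisfy the fractional matching condition of the moment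
  bound.\<close>

lemma sum_edges_on_card_containing_le:
  assumes V: "finite V" "K \<subseteq> matchings_on V" and U: "U \<subseteq> V"
  shows "(\<Sum>e\<in>edges_on U. real (card {m \<in> K. e \<in> m})) \<le> card K * (card U / 2)"
proof -
  have fU: "finite U" using U V finite_subset by blast
  have fK: "finite K" using V finite_matchings_on finite_subset by blast
  have "real (card (edges_on U \<inter> m)) \<le> card U / 2" if m: "m \<in> K" for m
  proof -
    have "card (\<Union>(edges_on U \<inter> m)) = 2 * card (edges_on U \<inter> m)"
      using m V matching_disjoint[of m V]
      by (intro card_Union_disjoint_edges[OF fU]) (auto intro: pairwise_subset)
    moreover have "card (\<Union>(edges_on U \<inter> m)) \<le> card U"
      using fU by (intro card_mono) (auto simp: edges_on_def)
    ultimately show ?thesis by simp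
  qed
  then have "(\<Sum>m\<in>K. real (card (edges_on U \<inter> m))) \<le> card K * (card U / 2)"
    using sum_mono[of K "\<lambda>m. real (card (edges_on U \<inter> m))" "\<lambda>_. card U / 2"] by simp
  then show ?thesis
    using sum_card_containing[of "edges_on U" K] finite_edges_on[OF fU] fK
    by (simp flip: of_nat_sum)
qed

text \<open>Since \<open>H\<close> is spread and \<open>2 * card B \<le> r\<close>, at least half of
  \<open>H\<close> avoids \<open>B - A\<close>. Such an \<open>m\<close> meets \<open>B\<close> in
  \<open>A \<inter> B\<close> only, in fewer than \<open>t\<close> edges, so the average of
  \<open>card (m \<inter> m')\<close> over \<open>K\<close> can reach \<open>t\<close> only if the
  densities of the other edges of \<open>m\<close> sum to at least 1. Then \<open>m\<close> is
  heavy, and heavy matchings are rare.\<close>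

lemma card_le_of_spread_outside:
  fixes r :: real
  assumes V: "finite V" "card V = 2 * n"
    and H: "H \<subseteq> matchings_on V" "\<And>m. m \<in> H \<Longrightarrow> A \<subseteq> m" "spread_outside r A H"
    and K: "K \<subseteq> matchings_on V" "K \<noteq> {}" "spread_outside r B K"
    and B: "finite B" "2 * card B \<le> r" "r > 0"
    and t: "\<And>m m'. m \<in> H \<Longrightarrow> m' \<in> K \<Longrightarrow> t \<le> card (m \<inter> m')" "card (A \<inter> B) < t"
  shows "card H \<le> 2 * ((2 * real n + 1) * odd_double_fact n * exp (- r / 16))"
proof -
  have fin: "finite H" "finite K"
    using V H(1) K(1) finite_matchings_on finite_subset by blast+
  have cK: "card K > 0" using fin K by (simp add: card_gt_0_iff)
  define H' where "H' = {m \<in> H. m \<inter> (B - A) = {}}"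
  \<comment> \<open>Edges of \<open>B\<close> may have density up to 1 in \<open>K\<close>; giving
    them weight 0 makes \<open>r * w e \<le> 1\<close> hold for every edge.\<close>
  define w where "w = (\<lambda>e. if e \<in> B then 0 else card {m \<in> K. e \<in> m} / real (card K))"
  have "card H \<le> 2 * real (card H')"
  proof -
    have "card (H - H') \<le> card (\<Union>e\<in>B-A. {m \<in> H. e \<in> m})"
      using B fin by (intro card_mono) (auto simp: H'_def)
    also have "\<dots> \<le> (\<Sum>e\<in>B-A. card {m \<in> H. e \<in> m})"
      using B by (intro card_UN_le) auto
    finally have "r * card (H - H') \<le> r * (\<Sum>e\<in>B-A. card {m \<in> H. e \<in> m})"
      using B by (intro mult_left_mono) linarith+
    also have "\<dots> = (\<Sum>e\<in>B-A. r * card {m \<in> H. e \<in> m})"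
      by (simp add: sum_distrib_left)
    also have "\<dots> \<le> (\<Sum>e\<in>B-A. card H)"
      unfolding of_nat_sum using H(3) by (intro sum_mono) (auto simp: spread_outside_def)
    also have "\<dots> \<le> card B * card H"
      using B by (auto intro!: mult_right_mono card_mono)
    finally have "2 * (r * card (H - H')) \<le> (2 * real (card B)) * card H" by simp
    also have "\<dots> \<le> r * card H" using B by (intro mult_right_mono) auto
    finally have "r * (2 * card (H - H')) \<le> r * card H" by simp
    then have "2 * real (card (H - H')) \<le> card H" using B by simp
    moreover have "card H = card (H - H') + card H'"
      using fin card_Diff_subset[of H' H] card_mono[of H H'] finite_subset[of H' H]
      by (auto simp: H'_def)
    ultimately show ?thesis by simp
  qed
  also have "card H' \<le> card {m \<in> matchings_on V. (\<Sum>e\<in>m. w e) \<ge> 1}"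
  proof (rule card_mono)
    show "H' \<subseteq> {m \<in> matchings_on V. (\<Sum>e\<in>m. w e) \<ge> 1}"
    proof
      fix m assume m: "m \<in> H'"
      then have mM: "m \<in> matchings_on V" "m \<in> H" using H by (auto simp: H'_def)
      have fm: "finite m" using finite_matching V mM by blast
      have mB: "m \<inter> B = A \<inter> B" using m H(2) by (auto simp: H'_def)
      have "card K * t \<le> (\<Sum>m'\<in>K. card (m \<inter> m'))"
        using t(1)[OF mM(2)] sum_mono[of K "\<lambda>_. t" "\<lambda>m'. card (m \<inter> m')"] by simp
      also have "\<dots> = (\<Sum>e\<in>m. card {m' \<in> K. e \<in> m'})"
        using sum_card_containing[of m K] fm fin by simp
      also have "\<dots> = (\<Sum>e\<in>m-B. card {m' \<in> K. e \<in> m'}) + (\<Sum>e\<in>m\<inter>B. card {m' \<in> K. e \<in> m'})"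
        using sum.Int_Diff[of m _ B] fm by (simp add: add.commute)
      also have "(\<Sum>e\<in>m\<inter>B. card {m' \<in> K. e \<in> m'}) \<le> (\<Sum>e\<in>m\<inter>B. card K)"
        using fin by (intro sum_mono card_mono) auto
      \<comment> \<open>The truncated difference is exact, because
        \<open>card (A \<inter> B) < t\<close> makes \<open>t\<close> positive.\<close>
      also have "(\<Sum>e\<in>m\<inter>B. card K) \<le> (t - 1) * card K"
        using t(2) mB by (auto intro!: mult_right_mono)
      finally have "card K * t \<le> (\<Sum>e\<in>m-B. card {m' \<in> K. e \<in> m'}) + (t - 1) * card K"
        by simp
      moreover have "card K * t = (t - 1) * card K + card K"
        using t(2) by (cases t) auto
      ultimately have "card K \<le> (\<Sum>e\<in>m-B. card {m' \<in> K. e \<in> m'})" by linarith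
      then have "real (card K) \<le> (\<Sum>e\<in>m-B. real (card {m' \<in> K. e \<in> m'}))"
        by (metis of_nat_mono of_nat_sum)
      then have "1 \<le> (\<Sum>e\<in>m-B. real (card {m' \<in> K. e \<in> m'})) / card K"
        using cK by simp
      also have "\<dots> = (\<Sum>e\<in>m-B. w e)"
        by (simp add: w_def sum_divide_distrib)
      also have "\<dots> = (\<Sum>e\<in>m. w e)"
        using fm by (intro sum.mono_neutral_left) (auto simp: w_def)
      finally show "m \<in> {m \<in> matchings_on V. (\<Sum>e\<in>m. w e) \<ge> 1}" using mM by simp
    qed
  qed (use V in \<open>simp add: finite_matchings_on\<close>)
  also have "real (card {m \<in> matchings_on V. (\<Sum>e\<in>m. w e) \<ge> 1})
      \<le> (2 * real n + 1) * odd_double_fact n * exp (- r / 16)"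
  proof (rule card_heavy_matchings_le[OF V])
    fix e
    show "w e \<ge> 0" by (simp add: w_def)
    show "r * w e \<le> 1"
      using K(3) cK by (auto simp: w_def spread_outside_def divide_simps)
  next
    fix U assume U: "U \<subseteq> V"
    have "(\<Sum>e\<in>edges_on U. w e) \<le> (\<Sum>e\<in>edges_on U. card {m \<in> K. e \<in> m} / card K)"
      by (intro sum_mono) (auto simp: w_def)
    also have "\<dots> = (\<Sum>e\<in>edges_on U. real (card {m \<in> K. e \<in> m})) / card K"
      by (simp add: sum_divide_distrib)
    also have "\<dots> \<le> card U / 2"
      using sum_edges_on_card_containing_le[OF V(1) K(1) U] cK by (simp add: divide_simps mult_ac)
    finally show "(\<Sum>e\<in>edges_on U. w e) \<le> card U / 2" .
  qed (use B in simp)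
  finally show ?thesis by simp
qed

section \<open>Cores of a family\<close>

text \<open>Here \<open>q\<close> bounds the size of the core and \<open>c\<close> is the least size
  of a witnessing subfamily. Nonemptiness is a separate clause since \<open>c\<close> is an
  arbitrary real.\<close>

definition is_core :: "real \<Rightarrow> real \<Rightarrow> nat \<Rightarrow> 'a set set \<Rightarrow> 'a set \<Rightarrow> bool" where
  "is_core r c q F A \<longleftrightarrow> finite A \<and> card A \<le> q \<and>
     (\<exists>H\<subseteq>F. H \<noteq> {} \<and> c \<le> card H \<and> (\<forall>m\<in>H. A \<subseteq> m) \<and> spread_outside r A H)"

lemma is_core_mono: "is_core r c q F A \<Longrightarrow> F \<subseteq> F' \<Longrightarrow> c' \<le> c \<Longrightarrow> is_core r c' q F' A"
  unfolding is_core_def by (meson order_trans)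

text \<open>If \<open>A\<close> and \<open>B\<close> shared fewer than \<open>t\<close> edges, a
  witnessing subfamily for \<open>A\<close> would be too large for
  \<open>card_le_of_spread_outside\<close>: \<open>c\<close> is chosen above that bound.\<close>

lemma cores_intersect:
  fixes r c :: real
  assumes V: "finite V" "card V = 2 * n"
    and F: "F \<subseteq> matchings_on V" "is_core r c q F A"
    and G: "G \<subseteq> matchings_on V" "is_core r c q G B"
    and t: "\<And>m m'. m \<in> F \<Longrightarrow> m' \<in> G \<Longrightarrow> t \<le> card (m \<inter> m')"
    and r: "2 * q \<le> r" "r > 0"
    and c: "2 * ((2 * real n + 1) * odd_double_fact n * exp (- r / 16)) < c"
  shows "t \<le> card (A \<inter> B)"
proof (rule ccontr)
  assume n: "\<not> t \<le> card (A \<inter> B)"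
  obtain H where H: "H \<subseteq> F" "c \<le> card H" "\<And>m. m \<in> H \<Longrightarrow> A \<subseteq> m" "spread_outside r A H"
    using F(2) unfolding is_core_def by blast
  obtain K where K: "K \<subseteq> G" "K \<noteq> {}" "spread_outside r B K" "finite B" "card B \<le> q"
    using G(2) unfolding is_core_def by blast
  have "card H \<le> 2 * ((2 * real n + 1) * odd_double_fact n * exp (- r / 16))"
  proof (rule card_le_of_spread_outside[OF V _ H(3,4) _ K(2,3,4)])
    show "H \<subseteq> matchings_on V" "K \<subseteq> matchings_on V" using H K F G by auto
    show "real (2 * card B) \<le> r" using K r by linarith
    show "t \<le> card (m \<inter> m')" if "m \<in> H" "m' \<in> K" for m m'
      using that t H K by blast
    show "card (A \<inter> B) < t" using n by simp
  qed (use r in auto)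
  with H(2) c show False by linarith
qed

lemma is_core_exists:
  fixes r :: real
  assumes V: "finite V" "card V = 2 * n"
    and F: "F \<subseteq> matchings_on V"
    and r: "r \<ge> 1" "odd_double_fact (n - Suc q) * r ^ Suc q < card F"
  shows "\<exists>A. is_core r (card F / r ^ q) q F A"
proof -
  have fF: "finite F" using F V finite_matchings_on finite_subset by blast
  \<comment> \<open>A maximiser of \<open>card {m \<in> F. A \<subseteq> m} * r ^ card A\<close> is spread outside itself; that it is not of
      the maximal allowed size \<open>Suc q\<close> leaves room to compare it with \<open>insert e A\<close>.\<close>
  define score where "score = (\<lambda>A. card {m \<in> F. A \<subseteq> m} * r ^ card A)"
  define S where "S = {A. A \<subseteq> edges_on V \<and> card A \<le> Suc q}"
  have S: "finite S" "{} \<in> S"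
    using finite_edges_on[OF V(1)] by (auto simp: S_def)
  have "Max (score ` S) \<in> score ` S"
    using S by (intro Max_in) auto
  then obtain A where A: "A \<in> S" "Max (score ` S) = score A" by blast
  have max: "score A' \<le> score A" if "A' \<in> S" for A'
    unfolding A(2)[symmetric] using S that by (intro Max_ge) auto
  have fA: "finite A" using A(1) finite_edges_on[OF V(1)] finite_subset by (auto simp: S_def)
  define H where "H = {m \<in> F. A \<subseteq> m}"
  have fH: "finite H" using fF by (simp add: H_def)
  \<comment> \<open>Comparison with the empty set, whose score is \<open>card F\<close>.\<close>
  have FA: "card F \<le> card H * r ^ card A"
    using max[OF S(2)] by (simp add: score_def H_def)
  have "card F > 0"
  proof -
    have "0 \<le> odd_double_fact (n - Suc q) * r ^ Suc q" using r by simp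
    then show ?thesis using r by linarith
  qed
  \<comment> \<open>With \<open>Suc q\<close> edges the score is at most $N_{q+1} r^{q+1}$, which is
    below \<open>card F\<close>.\<close>
  have "card A \<noteq> Suc q"
  proof
    assume a: "card A = Suc q"
    have "card H \<le> card {m \<in> matchings_on V. A \<subseteq> m}"
      using F V by (intro card_mono) (auto simp: H_def finite_matchings_on)
    also have "\<dots> \<le> odd_double_fact (n - Suc q)"
      using card_star_le[OF V, of A] a by simp
    finally have "card H * r ^ Suc q \<le> odd_double_fact (n - Suc q) * r ^ Suc q"
      using r by (intro mult_right_mono) auto
    then show False using FA r(2) unfolding a by linarith
  qed
  then have qA: "card A \<le> q" using A(1) by (simp add: S_def)
  have "r ^ card A \<le> r ^ q" using qA r by (intro power_increasing) auto
  then have "card H * r ^ card A \<le> card H * r ^ q"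
    by (intro mult_left_mono) auto
  then have c: "card F / r ^ q \<le> card H"
    using FA r by (simp add: divide_le_eq)
  have "spread_outside r A H"
    unfolding spread_outside_def
  proof (intro allI impI)
    fix e assume e: "e \<notin> A"
    show "r * card {m \<in> H. e \<in> m} \<le> card H"
    proof (cases "e \<in> edges_on V")
      case True
      then have "insert e A \<in> S" using A(1) qA fA by (auto simp: S_def card_insert_if)
      from max[OF this] have "card {m \<in> F. insert e A \<subseteq> m} * r ^ Suc (card A) \<le> card H * r ^ card A"
        using e fA by (simp add: score_def H_def)
      moreover have "{m \<in> F. insert e A \<subseteq> m} = {m \<in> H. e \<in> m}" by (auto simp: H_def)
      ultimately have "r * card {m \<in> H. e \<in> m} * r ^ card A \<le> card H * r ^ card A"
        by (simp add: mult_ac)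
      then show ?thesis using r by simp
    next
      case False
      then have "{m \<in> H. e \<in> m} = {}" using F matching_subset_edges by (fastforce simp: H_def)
      then show ?thesis by (simp only: card.empty of_nat_0 mult_zero_right of_nat_0_le_iff)
    qed
  qed
  moreover have "H \<noteq> {}"
    using FA \<open>card F > 0\<close> by auto
  ultimately have "is_core r (card F / r ^ q) q F A"
    unfolding is_core_def using fA qA c by (intro conjI exI[of _ H]) (auto simp: H_def)
  then show ?thesis by blast
qed

text \<open>If the members containing no core numbered more than \<open>\<theta>\<close>, they would
  have a core of their own. It would also be a core of \<open>F\<close>, yet its witnesses are
  members that contain it.\<close>

lemma card_no_core_le:
  fixes r \<theta> :: real
  assumes V: "finite V" "card V = 2 * n"
    and F: "F \<subseteq> matchings_on V"
    and r: "r \<ge> 1" "odd_double_fact (n - Suc q) * r ^ Suc q \<le> \<theta>"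
  shows "card {m \<in> F. \<forall>A. is_core r (\<theta> / r ^ q) q F A \<longrightarrow> \<not> A \<subseteq> m} \<le> \<theta>"
proof (rule ccontr)
  define F' where "F' = {m \<in> F. \<forall>A. is_core r (\<theta> / r ^ q) q F A \<longrightarrow> \<not> A \<subseteq> m}"
  assume "\<not> card {m \<in> F. \<forall>A. is_core r (\<theta> / r ^ q) q F A \<longrightarrow> \<not> A \<subseteq> m} \<le> \<theta>"
  then have F': "\<theta> < card F'" by (simp add: F'_def)
  have "\<exists>A. is_core r (card F' / r ^ q) q F' A"
    using F r F' by (intro is_core_exists[OF V]) (auto simp: F'_def)
  then obtain A where A: "is_core r (card F' / r ^ q) q F' A"
    by blast
  have "is_core r (\<theta> / r ^ q) q F A"
    using A F' r by (rule_tac is_core_mono[OF A]) (auto simp: F'_def divide_right_mono)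
  then have "\<forall>m\<in>F'. \<not> A \<subseteq> m" by (simp add: F'_def)
  then show False using A unfolding is_core_def by blast
qed

section \<open>Families covered by cores\<close>

text \<open>A set \<open>B\<close> that meets every member in \<open>card T\<close> elements without containing \<open>T\<close> forces one more
edge in addition to \<open>T\<close>, which gains a factor of order $1/n$ over the whole star.\<close>

lemma card_star_avoiding_le:
  assumes V: "finite V" "card V = 2 * n"
    and H: "H \<subseteq> matchings_on V" "\<And>m. m \<in> H \<Longrightarrow> T \<subseteq> m" "\<And>m. m \<in> H \<Longrightarrow> card T \<le> card (m \<inter> B)"
    and T: "finite T" "\<not> T \<subseteq> B" and B: "finite B"
  shows "card H \<le> card B * odd_double_fact (n - Suc (card T))"
proof -
  have "H \<subseteq> (\<Union>x\<in>B-T. {m \<in> matchings_on V. insert x T \<subseteq> m})"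
  proof
    fix m assume m: "m \<in> H"
    have "\<not> m \<inter> B \<subseteq> T"
    proof
      assume "m \<inter> B \<subseteq> T"
      then have "m \<inter> B \<subset> T" using T by auto
      then have "card (m \<inter> B) < card T" by (rule psubset_card_mono[OF T(1)])
      then show False using H(3)[OF m] by simp
    qed
    then show "m \<in> (\<Union>x\<in>B-T. {m \<in> matchings_on V. insert x T \<subseteq> m})"
      using H m by blast
  qed
  then have "card H \<le> card (\<Union>x\<in>B-T. {m \<in> matchings_on V. insert x T \<subseteq> m})"
    using V B by (intro card_mono) (auto simp: finite_matchings_on)
  also have "\<dots> \<le> (\<Sum>x\<in>B-T. card {m \<in> matchings_on V. insert x T \<subseteq> m})"
    using B by (intro card_UN_le) auto
  also have "\<dots> \<le> (\<Sum>x\<in>B-T. odd_double_fact (n - Suc (card T)))"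
  proof (rule sum_mono)
    fix x assume "x \<in> B - T"
    then show "card {m \<in> matchings_on V. insert x T \<subseteq> m} \<le> odd_double_fact (n - Suc (card T))"
      using card_star_le[OF V, of "insert x T"] T(1) by simp
  qed
  also have "\<dots> \<le> card B * odd_double_fact (n - Suc (card T))"
    using B by (simp add: card_mono)
  finally show ?thesis .
qed

text \<open>Each \<open>m\<close> contains some \<open>A\<close> that meets \<open>B\<close> in at
  least \<open>t\<close> elements, hence contains a \<open>t\<close>-subset of \<open>B\<close>
  lying in \<open>A\<close>. There are at most \<open>2 ^ q\<close> such subsets.\<close>

lemma card_le_of_subset_cover:
  assumes B: "finite B" "card B \<le> q"
    and AB: "\<And>m. m \<in> H \<Longrightarrow> \<exists>A\<in>\<A>. A \<subseteq> m \<and> t \<le> card (A \<inter> B)"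
    and H: "finite H"
    and b: "\<And>T. T \<subseteq> B \<Longrightarrow> card T = t \<Longrightarrow> card {m \<in> H. \<exists>A\<in>\<A>. T \<subseteq> A \<and> A \<subseteq> m} \<le> b"
  shows "card H \<le> 2 ^ q * b"
proof -
  define S where "S = {T \<in> Pow B. card T = t}"
  have "H \<subseteq> (\<Union>T\<in>S. {m \<in> H. \<exists>A\<in>\<A>. T \<subseteq> A \<and> A \<subseteq> m})"
  proof
    fix m assume m: "m \<in> H"
    with AB obtain A where A: "A \<in> \<A>" "A \<subseteq> m" "t \<le> card (A \<inter> B)" by blast
    obtain T where "T \<subseteq> A \<inter> B" "card T = t"
      using obtain_subset_with_card_n[OF A(3)] by blast
    then show "m \<in> (\<Union>T\<in>S. {m \<in> H. \<exists>A\<in>\<A>. T \<subseteq> A \<and> A \<subseteq> m})"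
      using A m by (auto simp: S_def)
  qed
  then have "card H \<le> card (\<Union>T\<in>S. {m \<in> H. \<exists>A\<in>\<A>. T \<subseteq> A \<and> A \<subseteq> m})"
    using B H by (intro card_mono) (auto simp: S_def)
  also have "\<dots> \<le> (\<Sum>T\<in>S. card {m \<in> H. \<exists>A\<in>\<A>. T \<subseteq> A \<and> A \<subseteq> m})"
    using B by (intro card_UN_le) (auto simp: S_def)
  also have "\<dots> \<le> (\<Sum>T\<in>S. b)"
    using b by (intro sum_mono) (auto simp: S_def)
  also have "\<dots> \<le> 2 ^ q * b"
  proof -
    have "card S \<le> card (Pow B)" using B by (intro card_mono) (auto simp: S_def)
    also have "\<dots> \<le> 2 ^ q" using B by (simp add: card_Pow)
    finally show ?thesis by simp
  qed
  finally show ?thesis .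
qed

text \<open>The cover by \<open>t\<close>-subsets handles the members that contain a core; the
  others number at most \<open>\<theta>\<close>. In the applications \<open>B\<close> is a single
  core of the other family.\<close>

lemma card_le_of_cores:
  fixes \<theta> :: real
  assumes B: "finite B" "card B \<le> q" "\<And>A. A \<in> \<A> \<Longrightarrow> t \<le> card (A \<inter> B)"
    and F: "finite F" "card {m \<in> F. \<forall>A\<in>\<A>. \<not> A \<subseteq> m} \<le> \<theta>"
    and b: "\<And>T. T \<subseteq> B \<Longrightarrow> card T = t \<Longrightarrow> card {m \<in> F. \<exists>A\<in>\<A>. T \<subseteq> A \<and> A \<subseteq> m} \<le> b"
  shows "card F \<le> 2 ^ q * real b + \<theta>"
proof -
  define F0 where "F0 = {m \<in> F. \<exists>A\<in>\<A>. A \<subseteq> m}"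
  have "card F0 \<le> 2 ^ q * b"
  proof (rule card_le_of_subset_cover[OF B(1,2), of F0 \<A> t])
    fix T assume T: "T \<subseteq> B" "card T = t"
    have "{m \<in> F0. \<exists>A\<in>\<A>. T \<subseteq> A \<and> A \<subseteq> m} = {m \<in> F. \<exists>A\<in>\<A>. T \<subseteq> A \<and> A \<subseteq> m}"
      by (auto simp: F0_def)
    then show "card {m \<in> F0. \<exists>A\<in>\<A>. T \<subseteq> A \<and> A \<subseteq> m} \<le> b" using b[OF T] by simp
  qed (use B F in \<open>auto simp: F0_def\<close>)
  then have "real (card F0) \<le> real (2 ^ q * b)" by (rule of_nat_mono)
  moreover have "F = F0 \<union> {m \<in> F. \<forall>A\<in>\<A>. \<not> A \<subseteq> m}" by (auto simp: F0_def)
  then have "card F \<le> card F0 + card {m \<in> F. \<forall>A\<in>\<A>. \<not> A \<subseteq> m}"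
    by (metis (no_types, lifting) card_Un_le)
  ultimately show ?thesis using F(2) by simp
qed

text \<open>Every member of \<open>G\<close> containing \<open>T\<close> meets \<open>m\<close> in
  at least \<open>t\<close> edges, so it contains one of the \<open>n\<close> edges of
  \<open>m\<close> besides \<open>T\<close>. This leaves at most $n N_{t+1} \<le> 2N_t/3$ of them,
  and the rest of \<open>G\<close> adds at most $\<theta> \<le> N_t/12$.\<close>

lemma card_le_of_not_star:
  fixes \<theta> :: real
  assumes V: "finite V" "card V = 2 * n"
    and F: "F \<subseteq> matchings_on V" "m \<in> F" "\<not> T \<subseteq> m"
    and G: "G \<subseteq> matchings_on V" "card {m \<in> G. \<not> T \<subseteq> m} \<le> \<theta>"
    and T: "finite T" "card T = t"
    and t: "\<And>m m'. m \<in> F \<Longrightarrow> m' \<in> G \<Longrightarrow> t \<le> card (m \<inter> m')"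
    and n: "\<theta> * n \<le> odd_double_fact (n - t)" "12 \<le> n" "4 * t + 2 \<le> n"
  shows "4 * real (card G) \<le> 3 * real (odd_double_fact (n - t))"
proof -
  define H where "H = {m' \<in> G. T \<subseteq> m'}"
  have mM: "m \<in> matchings_on V" using F by auto
  have cm: "finite m" "card m = n"
    using card_matching[OF V(1) mM] finite_matching[OF V(1) mM] V by auto
  have "card H \<le> card m * odd_double_fact (n - Suc (card T))"
    using G t[OF F(2)] T F cm
    by (intro card_star_avoiding_le[OF V]) (auto simp: H_def Int_commute)
  then have H: "card H \<le> n * odd_double_fact (n - Suc t)" using cm T by simp
  have "n - t = Suc (n - Suc t)" using n by simp
  then have N: "odd_double_fact (n - t) = (2 * (n - Suc t) + 1) * odd_double_fact (n - Suc t)"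
    by simp
  have "3 * card H \<le> 3 * n * odd_double_fact (n - Suc t)" using H by simp
  \<comment> \<open>This is $3n \<le> 4n - 4t - 2$.\<close>
  also have "\<dots> \<le> 2 * (2 * (n - Suc t) + 1) * odd_double_fact (n - Suc t)"
    using n by (intro mult_right_mono) auto
  also have "\<dots> = 2 * odd_double_fact (n - t)" using N by simp
  finally have "3 * card H \<le> 2 * odd_double_fact (n - t)" .
  then have "3 * real (card H) \<le> 2 * odd_double_fact (n - t)"
    by linarith
  moreover have "G = H \<union> {m \<in> G. \<not> T \<subseteq> m}" by (auto simp: H_def)
  then have "card G \<le> card H + card {m \<in> G. \<not> T \<subseteq> m}"
    by (metis (no_types, lifting) card_Un_le)
  moreover have "\<theta> * 12 \<le> \<theta> * n"
    using G(2) n(2) by (intro mult_left_mono) auto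
  ultimately show ?thesis using G(2) n(1) by linarith
qed

text \<open>If all members contain \<open>T\<close>, both families have at most $N_t$ members.
  Otherwise a member without \<open>T\<close> shrinks the opposite family to $3N_t/4$, which
  outweighs the possible excess \<open>\<theta>\<close> of its own family.\<close>

lemma card_mult_le_of_almost_star:
  fixes \<theta> :: real
  assumes V: "finite V" "card V = 2 * n"
    and F: "F \<subseteq> matchings_on V" "card {m \<in> F. \<not> T \<subseteq> m} \<le> \<theta>"
    and G: "G \<subseteq> matchings_on V" "card {m \<in> G. \<not> T \<subseteq> m} \<le> \<theta>"
    and T: "finite T" "card T = t"
    and t: "\<And>m m'. m \<in> F \<Longrightarrow> m' \<in> G \<Longrightarrow> t \<le> card (m \<inter> m')"
    and n: "\<theta> * n \<le> odd_double_fact (n - t)" "12 \<le> n" "4 * t + 2 \<le> n"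
  shows "real (card F) * card G \<le> (real (odd_double_fact (n - t)))\<^sup>2"
proof -
  define N where "N = real (odd_double_fact (n - t))"
  have N: "N > 0" by (simp add: N_def)
  have star: "card {m \<in> F. T \<subseteq> m} \<le> N" if "F \<subseteq> matchings_on V" for F
  proof -
    have "card {m \<in> F. T \<subseteq> m} \<le> card {m \<in> matchings_on V. T \<subseteq> m}"
      using that V by (intro card_mono) (auto simp: finite_matchings_on)
    then show ?thesis using card_star_le[OF V, of T] T by (simp add: N_def)
  qed
  have le: "card F \<le> N + \<theta>" if "F \<subseteq> matchings_on V" "card {m \<in> F. \<not> T \<subseteq> m} \<le> \<theta>" for F
  proof -
    have "F = {m \<in> F. T \<subseteq> m} \<union> {m \<in> F. \<not> T \<subseteq> m}" by auto
    then have "card F \<le> card {m \<in> F. T \<subseteq> m} + card {m \<in> F. \<not> T \<subseteq> m}"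
      by (metis (no_types, lifting) card_Un_le)
    then show ?thesis using star[OF that(1)] that(2) by linarith
  qed
  have "\<theta> * 12 \<le> \<theta> * n"
    using G(2) n(2) by (intro mult_left_mono) auto
  then have th: "\<theta> \<le> N / 12" using n(1) by (simp add: N_def)
  \<comment> \<open>The two factors $13/12$ and $3/4$ have product $13/16 < 1$.\<close>
  have prod: "x * y \<le> N\<^sup>2" if "0 \<le> x" "0 \<le> y" "x \<le> N + \<theta>" "4 * y \<le> 3 * N" for x y
  proof -
    have "x * y \<le> (13/12 * N) * (3/4 * N)"
      using that th by (intro mult_mono) auto
    also have "\<dots> \<le> N * N" using N by simp
    finally show ?thesis by (simp add: power2_eq_square)
  qed
  have "real (card F) * card G \<le> N\<^sup>2"
  proof (cases "\<exists>m\<in>F. \<not> T \<subseteq> m")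
    case True
    then obtain m where m: "m \<in> F" "\<not> T \<subseteq> m" by blast
    have "4 * real (card G) \<le> 3 * N"
      unfolding N_def by (rule card_le_of_not_star[OF V F(1) m G T _ n]) (use t in auto)
    then show ?thesis using le[OF F] by (intro prod) auto
  next
    case nF: False
    show ?thesis
    proof (cases "\<exists>m\<in>G. \<not> T \<subseteq> m")
      case True
      then obtain m where m: "m \<in> G" "\<not> T \<subseteq> m" by blast
      have "4 * real (card F) \<le> 3 * N"
        unfolding N_def
        by (rule card_le_of_not_star[OF V G(1) m F T _ n]) (metis t Int_commute)
      then show ?thesis using prod[of "card G" "card F"] le[OF G] by (simp add: mult.commute)
    next
      case False
      then have "{m \<in> F. T \<subseteq> m} = F" "{m \<in> G. T \<subseteq> m} = G" using nF by auto
      then have "card F \<le> N" "card G \<le> N" using star[OF F(1)] star[OF G(1)] by auto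
      then show ?thesis using N unfolding power2_eq_square by (intro mult_mono) auto
    qed
  qed
  then show ?thesis by (simp add: N_def)
qed

text \<open>There are three cases. A family without cores has at most \<open>\<theta>\<close>
  members, against at most $(2n-1)!!$ in the other. If the cores have no common
  \<open>t\<close>-set, one family is smaller than $N_t$ by an order of $n$ and the other is
  $O(N_t)$. If they have one, both families are almost contained in its star.\<close>

lemma card_mult_le_of_cores:
  fixes \<theta> :: real
  assumes V: "finite V" "card V = 2 * n"
    and F: "F \<subseteq> matchings_on V" "card {m \<in> F. \<forall>A\<in>\<A>. \<not> A \<subseteq> m} \<le> \<theta>"
    and G: "G \<subseteq> matchings_on V" "card {m \<in> G. \<forall>B\<in>\<B>. \<not> B \<subseteq> m} \<le> \<theta>"
    and A: "\<And>A. A \<in> \<A> \<Longrightarrow> finite A \<and> card A \<le> q"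
    and B: "\<And>B. B \<in> \<B> \<Longrightarrow> finite B \<and> card B \<le> q"
    and AB: "\<And>A B. A \<in> \<A> \<Longrightarrow> B \<in> \<B> \<Longrightarrow> t \<le> card (A \<inter> B)"
    and t: "\<And>m m'. m \<in> F \<Longrightarrow> m' \<in> G \<Longrightarrow> t \<le> card (m \<inter> m')"
    and n: "\<theta> * n \<le> odd_double_fact (n - t)" "12 \<le> n" "4 * t + 2 \<le> n"
      "2 ^ Suc q * (2 ^ q * q + 1) \<le> n"
    and \<theta>: "\<theta> * odd_double_fact n \<le> (real (odd_double_fact (n - t)))\<^sup>2"
  shows "real (card F) * card G \<le> (real (odd_double_fact (n - t)))\<^sup>2"
proof -
  define N where "N = real (odd_double_fact (n - t))"
  define N1 where "N1 = odd_double_fact (n - Suc t)"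
  have N: "N > 0" by (simp add: N_def)
  have th0: "\<theta> \<ge> 0" using F(2) by linarith
  have "\<theta> * 1 \<le> \<theta> * n" using th0 n(2) by (intro mult_left_mono) auto
  then have thN: "\<theta> \<le> N" using n(1) by (simp add: N_def)
  have "n - t = Suc (n - Suc t)" using n by simp
  then have "odd_double_fact (n - t) = (2 * (n - Suc t) + 1) * N1" by (simp add: N1_def)
  moreover have "n * N1 \<le> (2 * (n - Suc t) + 1) * N1" using n by (intro mult_right_mono) auto
  ultimately have "n * N1 \<le> odd_double_fact (n - t)" by simp
  then have nN1: "n * real N1 \<le> N" unfolding N_def by (metis of_nat_mono of_nat_mult)
  have fin: "finite F" "finite G"
    using F(1) G(1) V finite_matchings_on finite_subset by blast+
  have le_all: "card F \<le> odd_double_fact n" if "F \<subseteq> matchings_on V" for F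
    using card_mono[OF finite_matchings_on[OF V(1)] that] card_matchings_le[OF V] by linarith
  have star: "card {m \<in> F. \<exists>A\<in>\<A>. T \<subseteq> A \<and> A \<subseteq> m} \<le> odd_double_fact (n - card T)"
    if "F \<subseteq> matchings_on V" for F \<A> T
  proof -
    have "card {m \<in> F. \<exists>A\<in>\<A>. T \<subseteq> A \<and> A \<subseteq> m} \<le> card {m \<in> matchings_on V. T \<subseteq> m}"
      using that V by (intro card_mono) (auto simp: finite_matchings_on)
    then show ?thesis using card_star_le[OF V, of T] by simp
  qed
  \<comment> \<open>Among the members with a core containing \<open>T\<close>, a core
    \<open>B\<close> of the other family that misses \<open>T\<close> forces an extra edge of
    \<open>B\<close>.\<close>
  have gain: "card {m \<in> F. \<exists>A\<in>\<A>. T \<subseteq> A \<and> A \<subseteq> m} \<le> q * N1"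
    if "F \<subseteq> matchings_on V" "finite B" "card B \<le> q" "finite T" "card T = t" "\<not> T \<subseteq> B"
      "\<And>A. A \<in> \<A> \<Longrightarrow> t \<le> card (A \<inter> B)" for F \<A> T B
  proof -
    have "card {m \<in> F. \<exists>A\<in>\<A>. T \<subseteq> A \<and> A \<subseteq> m} \<le> card B * odd_double_fact (n - Suc (card T))"
    proof (rule card_star_avoiding_le[OF V])
      fix m assume "m \<in> {m \<in> F. \<exists>A\<in>\<A>. T \<subseteq> A \<and> A \<subseteq> m}"
      then obtain A where "A \<in> \<A>" "A \<subseteq> m" by blast
      then have "t \<le> card (A \<inter> B)" "card (A \<inter> B) \<le> card (m \<inter> B)"
        using that by (auto intro!: card_mono)
      then show "card T \<le> card (m \<inter> B)" using that(5) by linarith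
    qed (use that in auto)
    also have "\<dots> \<le> q * N1" using that by (simp add: N1_def)
    finally show ?thesis .
  qed
  \<comment> \<open>Here \<open>n * N1 \<le> N\<close> gives
    \<open>n * y \<le> (2 ^ q * q + 1) * N\<close>, and the fourth lower bound on \<open>n\<close>
    absorbs all constants depending on \<open>q\<close>.\<close>
  have prod: "x * y \<le> N\<^sup>2"
    if "0 \<le> x" "0 \<le> y" "x \<le> 2 ^ q * N + \<theta>" "y \<le> 2 ^ q * (q * N1) + \<theta>" for x y
  proof -
    have x: "x \<le> 2 ^ Suc q * N"
    proof -
      have "1 * N \<le> 2 ^ q * N" using N by (intro mult_right_mono) auto
      then show ?thesis using that thN by simp
    qed
    have "n * y \<le> n * (2 ^ q * (q * N1) + \<theta>)"
      using that by (intro mult_left_mono) auto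
    also have "\<dots> = 2 ^ q * q * (n * real N1) + \<theta> * n" by (simp add: algebra_simps)
    also have "\<dots> \<le> 2 ^ q * q * N + N"
      using nN1 n(1) by (intro add_mono mult_left_mono) (auto simp: N_def)
    finally have ny: "n * y \<le> (2 ^ q * q + 1) * N" by (simp add: algebra_simps)
    have "n * (x * y) = x * (n * y)" by simp
    also have "\<dots> \<le> (2 ^ Suc q * N) * ((2 ^ q * q + 1) * N)"
      by (rule mult_mono) (use x ny that N in auto)
    also have "\<dots> = real (2 ^ Suc q * (2 ^ q * q + 1)) * N\<^sup>2"
      by (simp add: power2_eq_square algebra_simps)
    also have "\<dots> \<le> n * N\<^sup>2"
      using n(4) by (intro mult_right_mono of_nat_mono) auto
    finally show ?thesis using n(2) by simp
  qed
  have "real (card F) * card G \<le> N\<^sup>2"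
  proof (cases "\<A> = {} \<or> \<B> = {}")
    case True
    then have "real (card F) * card G \<le> \<theta> * odd_double_fact n"
    proof
      assume "\<A> = {}"
      then have "card F \<le> \<theta>" using F(2) by simp
      then show ?thesis using le_all[OF G(1)] th0 by (intro mult_mono) auto
    next
      assume "\<B> = {}"
      then have "card G \<le> \<theta>" using G(2) by simp
      then have "card G * real (card F) \<le> \<theta> * odd_double_fact n"
        using le_all[OF F(1)] th0 by (intro mult_mono) auto
      then show ?thesis by (simp add: mult.commute)
    qed
    then show ?thesis using \<theta> by (simp add: N_def)
  next
    case False
    then obtain A0 B0 where A0: "A0 \<in> \<A>" and B0: "B0 \<in> \<B>" by blast
    have BA: "t \<le> card (B \<inter> A)" if "A \<in> \<A>" "B \<in> \<B>" for A B
      using AB[OF that] by (simp add: Int_commute)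
    have F1: "card F \<le> 2 ^ q * N + \<theta>"
      unfolding N_def using B[OF B0] AB[OF _ B0] fin F star[OF F(1)]
      by (intro card_le_of_cores[of B0 q \<A> t]) auto
    have G1: "card G \<le> 2 ^ q * N + \<theta>"
      unfolding N_def using A[OF A0] BA[OF A0] fin G star[OF G(1)]
      by (intro card_le_of_cores[of A0 q \<B> t]) auto
    show ?thesis
    proof (cases "\<exists>T. finite T \<and> card T = t \<and> (\<forall>B\<in>\<B>. T \<subseteq> B)")
      \<comment> \<open>Every \<open>t\<close>-subset \<open>T\<close> of \<open>B0\<close> is
        missed by some core \<open>B1\<close>, which depends on \<open>T\<close>, so the gain
        applies to each term of the cover of \<open>F\<close>.\<close>
      case False
      have "card F \<le> 2 ^ q * real (q * N1) + \<theta>"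
      proof (rule card_le_of_cores[of B0 q \<A> t])
        fix T assume T: "T \<subseteq> B0" "card T = t"
        then have fT: "finite T" using B[OF B0] finite_subset by blast
        then obtain B1 where B1: "B1 \<in> \<B>" "\<not> T \<subseteq> B1" using False T by blast
        show "card {m \<in> F. \<exists>A\<in>\<A>. T \<subseteq> A \<and> A \<subseteq> m} \<le> q * N1"
          using B[OF B1(1)] AB[OF _ B1(1)] by (intro gain[OF F(1) _ _ fT T(2) B1(2)]) auto
      qed (use B[OF B0] AB[OF _ B0] fin F in auto)
      then have "card G * real (card F) \<le> N\<^sup>2" using G1 by (intro prod) auto
      then show ?thesis by (simp add: mult.commute)
    next
      case True
      then obtain T where T: "finite T" "card T = t" "\<And>B. B \<in> \<B> \<Longrightarrow> T \<subseteq> B" by blast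
      show ?thesis
      proof (cases "\<forall>A\<in>\<A>. T \<subseteq> A")
        \<comment> \<open>All cores of \<open>G\<close> contain this one \<open>T\<close>, so a
          single gain, from \<open>A1\<close>, bounds the part of \<open>G\<close> covered by
          cores.\<close>
        case False
        then obtain A1 where A1: "A1 \<in> \<A>" "\<not> T \<subseteq> A1" by blast
        have "card {m \<in> G. \<exists>B\<in>\<B>. T \<subseteq> B \<and> B \<subseteq> m} \<le> q * N1"
          using A[OF A1(1)] BA[OF A1(1)] by (intro gain[OF G(1) _ _ T(1,2) A1(2)]) auto
        moreover have "G = {m \<in> G. \<exists>B\<in>\<B>. T \<subseteq> B \<and> B \<subseteq> m} \<union> {m \<in> G. \<forall>B\<in>\<B>. \<not> B \<subseteq> m}"
          using T(3) by blast
        then have "card G \<le> card {m \<in> G. \<exists>B\<in>\<B>. T \<subseteq> B \<and> B \<subseteq> m}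
            + card {m \<in> G. \<forall>B\<in>\<B>. \<not> B \<subseteq> m}"
          by (metis (no_types, lifting) card_Un_le)
        ultimately have "real (card G) \<le> real (q * N1) + \<theta>"
          using G(2) by linarith
        moreover have "1 * real (q * N1) \<le> 2 ^ q * real (q * N1)"
          by (intro mult_right_mono) auto
        ultimately show ?thesis using F1 by (intro prod) auto
      next
        case TA: True
        have "card {m \<in> F. \<not> T \<subseteq> m} \<le> card {m \<in> F. \<forall>A\<in>\<A>. \<not> A \<subseteq> m}"
          using TA fin by (intro card_mono) auto
        then have F2: "card {m \<in> F. \<not> T \<subseteq> m} \<le> \<theta>" using F(2) by linarith
        have "card {m \<in> G. \<not> T \<subseteq> m} \<le> card {m \<in> G. \<forall>B\<in>\<B>. \<not> B \<subseteq> m}"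
          using T(3) fin by (intro card_mono) auto
        then have G2: "card {m \<in> G. \<not> T \<subseteq> m} \<le> \<theta>" using G(2) by linarith
        show ?thesis
          unfolding N_def
          by (rule card_mult_le_of_almost_star[OF V F(1) F2 G(1) G2 T(1,2) _ n(1-3)])
             (use t in auto)
      qed
    qed
  qed
  then show ?thesis by (simp add: N_def)
qed

section \<open>Growth estimates and choice of parameters\<close>

lemma odd_double_fact_le_power_mult:
  "t \<le> n \<Longrightarrow> odd_double_fact n \<le> (2 * n) ^ t * odd_double_fact (n - t)"
proof (induction t)
  case (Suc t)
  then have "n - t = Suc (n - Suc t)" by simp
  then have "odd_double_fact (n - t) = (2 * (n - Suc t) + 1) * odd_double_fact (n - Suc t)"
    by simp
  also have "\<dots> \<le> (2 * n) * odd_double_fact (n - Suc t)"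
    using Suc.prems by (intro mult_right_mono) auto
  finally have "(2 * n) ^ t * odd_double_fact (n - t) \<le> (2 * n) ^ t * ((2 * n) * odd_double_fact (n - Suc t))"
    by (rule mult_left_mono) simp
  also have "\<dots> = (2 * n) ^ Suc t * odd_double_fact (n - Suc t)"
    by (simp only: power_Suc2 mult.assoc)
  finally have "(2 * n) ^ t * odd_double_fact (n - t) \<le> (2 * n) ^ Suc t * odd_double_fact (n - Suc t)" .
  moreover have "odd_double_fact n \<le> (2 * n) ^ t * odd_double_fact (n - t)" using Suc by simp
  ultimately show ?case using le_trans by blast
qed simp

text \<open>The \<open>j\<close> factors removed come from the upper half of the product:
  \<open>2 * (t + j) \<le> n\<close> keeps each of them at least \<open>n\<close>.\<close>

lemma power_mult_odd_double_fact_le: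
  "2 * (t + j) \<le> n \<Longrightarrow> n ^ j * odd_double_fact (n - (t + j)) \<le> odd_double_fact (n - t)"
proof (induction j)
  case (Suc j)
  then have "n - (t + j) = Suc (n - (t + Suc j))" by simp
  then have eq: "odd_double_fact (n - (t + j)) = (2 * (n - (t + Suc j)) + 1) * odd_double_fact (n - (t + Suc j))"
    by simp
  have "n * odd_double_fact (n - (t + Suc j)) \<le> odd_double_fact (n - (t + j))"
    unfolding eq using Suc.prems by (intro mult_right_mono) auto
  then have "n ^ j * (n * odd_double_fact (n - (t + Suc j))) \<le> n ^ j * odd_double_fact (n - (t + j))"
    by (rule mult_left_mono) simp
  also have "\<dots> \<le> odd_double_fact (n - t)" using Suc by simp
  finally show ?case by (simp add: mult_ac)
qed simp

lemma power_sqrt_less_exp: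
  fixes C a :: real
  assumes "C > 0" "a > 0"
  shows "\<exists>n0. \<forall>n\<ge>n0. C * sqrt (real n) ^ k < exp (sqrt (real n) / a)"
proof -
  have "\<forall>\<^sub>F x in at_top. x ^ k / exp x < 1 / (C * a ^ k)"
    using assms by (intro order_tendstoD(2)[OF tendsto_power_div_exp_0]) auto
  then obtain X where X: "\<And>x. x \<ge> X \<Longrightarrow> x ^ k / exp x < 1 / (C * a ^ k)"
    by (auto simp: eventually_at_top_linorder)
  show ?thesis
  proof (intro exI[of _ "nat \<lceil>(a * X)\<^sup>2\<rceil>"] allI impI)
    fix n assume "nat \<lceil>(a * X)\<^sup>2\<rceil> \<le> n"
    then have "(a * X)\<^sup>2 \<le> real n" by linarith
    then have "a * X \<le> sqrt (real n)" by (rule real_le_rsqrt)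
    then have "X \<le> sqrt (real n) / a" using assms by (simp add: field_simps)
    from X[OF this] show "C * sqrt (real n) ^ k < exp (sqrt (real n) / a)"
      using assms by (simp add: field_simps power_divide)
  qed
qed

theorem mainTheorem7:
  shows "\<forall>t::nat. \<exists>n0::nat. \<forall>n\<ge>n0. \<forall>F G.
     F \<subseteq> perfect_matchings n \<longrightarrow> G \<subseteq> perfect_matchings n \<longrightarrow>
     t_cross_intersecting t F G \<longrightarrow>
     card F * card G \<le> (odd_double_fact (n - t))^2"
proof
  fix t :: nat
  \<comment> \<open>Large enough that $N_{q+1} r^{q+1} \<le> \<theta>$. Cancelling $N_t$ and writing
    $n = r^2$, this asks for $q + 1 + 2(2t+1) = 10t + 5$ to be at most $2(q+1-t) = 10t + 6$.\<close>
  define q where "q = 6 * t + 2"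
  \<comment> \<open>The exponent collects two factors $n^{2t+1}$, which give $8t+4$, and $r^q$; the
    6 comes from $2(2n+1) \<le> 6n$.\<close>
  obtain n1 where n1: "\<And>n. n \<ge> n1 \<Longrightarrow> 6 * sqrt (real n) ^ (14 * t + 6) < exp (sqrt (real n) / 16)"
    using power_sqrt_less_exp[of 6 16 "14 * t + 6"] by auto
  \<comment> \<open>The term \<open>4 * q\<^sup>2\<close> yields \<open>2 * q \<le> r\<close>,
    \<open>4 * q\<close> yields the linear conditions on \<open>t\<close>, and the last summand is
    the constant of \<open>card_mult_le_of_cores\<close>.\<close>
  define n0 where "n0 = n1 + 12 + 4 * q\<^sup>2 + 4 * q + 2 ^ Suc q * (2 ^ q * q + 1)"
  show "\<exists>n0::nat. \<forall>n\<ge>n0. \<forall>F G.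
     F \<subseteq> perfect_matchings n \<longrightarrow> G \<subseteq> perfect_matchings n \<longrightarrow>
     t_cross_intersecting t F G \<longrightarrow>
     card F * card G \<le> (odd_double_fact (n - t))^2"
  proof (intro exI[of _ n0] allI impI)
    fix n F G
    assume "n0 \<le> n" and F: "F \<subseteq> perfect_matchings n" and G: "G \<subseteq> perfect_matchings n"
      and FG: "t_cross_intersecting t F G"
    then have n: "n1 \<le> n" "12 \<le> n" "4 * q\<^sup>2 \<le> n" "4 * q \<le> n" "2 ^ Suc q * (2 ^ q * q + 1) \<le> n"
      by (auto simp: n0_def)
    define V where "V = {0..<2*n}"
    have V: "finite V" "card V = 2 * n" by (auto simp: V_def)
    note F = F[unfolded perfect_matchings_eq, folded V_def]
    note G = G[unfolded perfect_matchings_eq, folded V_def]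
    have t: "t \<le> card (m \<inter> m')" if "m \<in> F" "m' \<in> G" for m m'
      using FG that by (simp add: t_cross_intersecting_def)
    define r where "r = sqrt (real n)"
    define N where "N = real (odd_double_fact (n - t))"
    \<comment> \<open>As $(2n-1)!! \<le> n^{2t} N$, this choice gives both $\<theta> n \<le> N$ and
      $\<theta> (2n-1)!! \<le> N^2/n$.\<close>
    define \<theta> where "\<theta> = N / real n ^ (2 * t + 1)"
    define c where "c = \<theta> / r ^ q"
    have N: "N > 0" by (simp add: N_def)
    have r1: "r \<ge> 1" using n by (simp add: r_def)
    have rn: "real n = r ^ 2" by (simp add: r_def)
    have rq: "2 * q \<le> r"
      unfolding r_def using n(3) by (intro real_le_rsqrt) (simp add: power2_eq_square flip: of_nat_mult)
    have N0: "odd_double_fact n \<le> real n ^ (2 * t) * N"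
    proof -
      have "odd_double_fact n \<le> (2 * n) ^ t * odd_double_fact (n - t)"
        using n by (intro odd_double_fact_le_power_mult) (simp add: q_def)
      also have "\<dots> \<le> (n ^ 2) ^ t * odd_double_fact (n - t)"
        using n by (intro mult_right_mono power_mono) (auto simp: power2_eq_square)
      finally have "odd_double_fact n \<le> n ^ (2 * t) * odd_double_fact (n - t)"
        by (simp add: power_mult)
      then show ?thesis
        unfolding N_def by (metis of_nat_mono of_nat_mult of_nat_power)
    qed
    have rem: "odd_double_fact (n - Suc q) * r ^ Suc q \<le> \<theta>"
    proof -
      have "2 * (t + (5 * t + 3)) \<le> n" using n by (simp add: q_def)
      moreover have "t + (5 * t + 3) = Suc q" by (simp add: q_def)
      ultimately have "n ^ (5 * t + 3) * odd_double_fact (n - Suc q) \<le> odd_double_fact (n - t)"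
        by (metis power_mult_odd_double_fact_le)
      then have le: "real n ^ (5 * t + 3) * odd_double_fact (n - Suc q) \<le> N"
        unfolding N_def by (metis of_nat_mono of_nat_mult of_nat_power)
      have "r ^ Suc q * real n ^ (2 * t + 1) = r ^ (Suc q + 2 * (2 * t + 1))"
        by (simp only: rn power_add power_mult)
      also have "\<dots> \<le> r ^ (2 * (5 * t + 3))"
        using r1 by (intro power_increasing) (auto simp: q_def)
      also have "\<dots> = real n ^ (5 * t + 3)" by (simp only: rn power_mult)
      finally have "odd_double_fact (n - Suc q) * (r ^ Suc q * real n ^ (2 * t + 1))
          \<le> odd_double_fact (n - Suc q) * real n ^ (5 * t + 3)"
        by (rule mult_left_mono) simp
      also have "\<dots> \<le> N" using le by (simp only: mult.commute)
      finally have "odd_double_fact (n - Suc q) * r ^ Suc q * real n ^ (2 * t + 1) \<le> N"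
        by (simp only: mult.assoc)
      then show ?thesis using n by (simp only: \<theta>_def le_divide_eq) simp
    qed
    \<comment> \<open>The losses are all polynomial in \<open>r\<close>, so $e^{-r/16}$ beats them
      once \<open>n\<close> is at least \<open>n1\<close>.\<close>
    have c: "2 * ((2 * real n + 1) * odd_double_fact n * exp (- r / 16)) < c"
    proof -
      have "2 * ((2 * real n + 1) * odd_double_fact n) \<le> 2 * ((3 * real n) * (real n ^ (2 * t) * N))"
        using N0 N n by (intro mult_left_mono mult_mono) auto
      also have "\<dots> = 6 * real n ^ (2 * t + 1) * N" by simp
      finally have "2 * ((2 * real n + 1) * odd_double_fact n) * (real n ^ (2 * t + 1) * r ^ q)
          \<le> 6 * real n ^ (2 * t + 1) * N * (real n ^ (2 * t + 1) * r ^ q)"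
        using r1 by (intro mult_right_mono) auto
      also have "\<dots> = 6 * r ^ (2 * (2 * t + 1) + 2 * (2 * t + 1) + q) * N"
        by (simp only: rn power_add power_mult mult_ac)
      also have "2 * (2 * t + 1) + 2 * (2 * t + 1) + q = 14 * t + 6"
        by (simp add: q_def)
      also have "6 * r ^ (14 * t + 6) * N < exp (r / 16) * N"
        using n1[OF n(1)] N by (intro mult_strict_right_mono) (auto simp: r_def)
      finally have "2 * ((2 * real n + 1) * odd_double_fact n) * (real n ^ (2 * t + 1) * r ^ q) / exp (r / 16) < N"
        by (simp add: divide_less_eq mult.commute)
      then show ?thesis
        using n r1 by (simp add: c_def \<theta>_def exp_minus field_simps)
    qed
    have "real (card F) * card G \<le> (real (odd_double_fact (n - t)))\<^sup>2"
    proof (rule card_mult_le_of_cores[OF V F _ G,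
          of "{A. is_core r c q F A}" \<theta> "{B. is_core r c q G B}" q t])
      show "card {m \<in> F. \<forall>A\<in>{A. is_core r c q F A}. \<not> A \<subseteq> m} \<le> \<theta>"
        using card_no_core_le[OF V F r1 rem] by (simp add: c_def)
      show "card {m \<in> G. \<forall>A\<in>{A. is_core r c q G A}. \<not> A \<subseteq> m} \<le> \<theta>"
        using card_no_core_le[OF V G r1 rem] by (simp add: c_def)
      show "t \<le> card (A \<inter> B)" if "A \<in> {A. is_core r c q F A}" "B \<in> {A. is_core r c q G A}" for A B
        by (rule cores_intersect[OF V F _ G _ _ _ _ c]) (use that r1 rq in \<open>auto intro: t\<close>)
      have "\<theta> * n = N / real n ^ (2 * t)" using n by (simp add: \<theta>_def)
      also have "\<dots> \<le> N / 1" using n N by (intro divide_left_mono) auto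
      finally show "\<theta> * n \<le> odd_double_fact (n - t)" by (simp add: N_def)
      have "\<theta> * odd_double_fact n \<le> \<theta> * (real n ^ (2 * t) * N)"
        using N0 N by (intro mult_left_mono) (auto simp: \<theta>_def)
      also have "\<dots> = N * (N / n)" using n by (simp add: \<theta>_def)
      also have "\<dots> \<le> N * (N / 1)" using n N by (intro mult_left_mono divide_left_mono) auto
      finally show "\<theta> * odd_double_fact n \<le> (real (odd_double_fact (n - t)))\<^sup>2"
        by (simp add: N_def power2_eq_square)
    qed (use n in \<open>auto simp: is_core_def q_def intro: t\<close>)
    then show "card F * card G \<le> (odd_double_fact (n - t))^2"
      by (simp flip: of_nat_mult of_nat_power)
  qed
qed

end
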